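(* Let $G$ be a finite group, $\mathbb{F}$ a field, $k\geq 1$, and let $X_0,X_1,\dots,X_k$ be linear subspaces of the group algebra $\mathbb{F}[G]$ such that $X_0X_1\cdots X_k=0$. Put $t_i=\operatorname{codim}X_i$. Let $A_1,\dots,A_k$ be arbitrary subsets of $G$. Then there exist subsets $B_i\subset A_i$, $i=1,\dots,k$, and a subset $C\subset G$ such that $|C|\leq t_0$, $|B_i|\leq t_i$ for all $i=1,\dots,k$, and $$A_1A_2\cdots A_k\subset C\cup B_1A_2\cdots A_k\cup A_1B_2A_3\cdots A_k\cup\dots\cup A_1A_2\cdots A_{k-1}B_k.$$ Moreover, the sets can be chosen so that additionally $B_i=B_j$ for all $1\leq i<j\leq k$ for which simultaneously $X_i=X_j$ and $A_i=A_j$.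
   Context: $X_0X_1\cdots X_k=0$ means that $u_0u_1\cdots u_k=0$ in $\mathbb{F}[G]$ for all $u_i\in X_i$, $i=0,\dots,k$. Codimensions are taken in $\mathbb{F}[G]$, so $t_i=|G|-\dim_{\mathbb{F}}X_i$. For subsets $S_1,\dots,S_k\subset G$, $S_1S_2\cdots S_k=\{s_1s_2\cdots s_k: s_i\in S_i\}$. *)

theory Defs
  imports Complex_Main "HOL-Library.Cardinality" "HOL-Library.Poly_Mapping" "HOL-Library.Set_Algebras"
begin

text \<open>
  For a type \<open>'g\<close> of class \<^class>\<open>group_add\<close> (a group written additively, but not assumed to be
  commutative) the ring \<open>'g \<Rightarrow>\<^sub>0 'f\<close> carries the convolution product, so for a field
  \<open>'f\<close> it is the group algebra of \<open>'g\<close> over \<open>'f\<close>; the basis element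
  of a group element \<open>g\<close> is \<open>Poly_Mapping.single g 1\<close>.  Accordingly, the product set
  of subsets \<open>S\<close>, \<open>T\<close> of the group is written \<open>S + T\<close>, with factors in this order.
\<close>

definition ga_scale :: "'f::field \<Rightarrow> ('g \<Rightarrow>\<^sub>0 'f) \<Rightarrow> ('g \<Rightarrow>\<^sub>0 'f)"
  where "ga_scale c u = Poly_Mapping.map ((*) c) u"

lemma lookup_ga_scale [simp]:
  "Poly_Mapping.lookup (ga_scale c u) g = c * Poly_Mapping.lookup u g"
  by (simp add: ga_scale_def map.rep_eq when_def)

global_interpretation ga: vector_space ga_scale
  by unfold_locales (auto intro!: poly_mapping_eqI simp: lookup_add algebra_simps)

lemma ga_dim_UNIV: "ga.dim (UNIV :: ('g::finite \<Rightarrow>\<^sub>0 'f::field) set) = CARD('g)"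
proof -
  let ?e = "\<lambda>g. Poly_Mapping.single g (1::'f) :: 'g \<Rightarrow>\<^sub>0 'f"
  have inj: "inj ?e"
    by (rule injI) (metis lookup_single_eq lookup_single_not_eq zero_neq_one)
  have expand: "u = (\<Sum>g\<in>UNIV. ga_scale (Poly_Mapping.lookup u g) (?e g))" for u :: "'g \<Rightarrow>\<^sub>0 'f"
    by (rule poly_mapping_eqI) (simp add: lookup_sum lookup_single when_def if_distrib cong: if_cong)
  have "u \<in> ga.span (range ?e)" for u :: "'g \<Rightarrow>\<^sub>0 'f"
    by (subst expand[of u]) (intro ga.span_sum ga.span_scale ga.span_base, simp)
  then have span: "UNIV \<subseteq> ga.span (range ?e)"
    by blast
  have "ga.independent (range ?e)"
  proof (rule ga.independent_if_scalars_zero)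
    show "finite (range ?e)" by simp
    fix f x assume 0: "(\<Sum>x\<in>range ?e. ga_scale (f x) x) = 0" and "x \<in> range ?e"
    then obtain g where x: "x = ?e g" by blast
    have "0 = Poly_Mapping.lookup (\<Sum>h\<in>UNIV. ga_scale (f (?e h)) (?e h)) g"
      using 0 by (simp add: sum.reindex[OF inj] o_def)
    also have "\<dots> = f (?e g)"
      by (simp add: lookup_sum lookup_single when_def if_distrib cong: if_cong)
    finally show "f x = 0" using x by simp
  qed
  then have "ga.dim (UNIV :: ('g \<Rightarrow>\<^sub>0 'f) set) = card (range ?e)"
    using span by (intro ga.dim_unique) auto
  then show ?thesis by (simp add: card_image[OF inj])
qed

text \<open>
  The subtraction is not truncated: for a subspace \<open>X\<close> the dimension is at most the
  dimension \<open>CARD('g)\<close> of the whole group algebra.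
\<close>

definition ga_codim :: "('g::{group_add,finite} \<Rightarrow>\<^sub>0 'f::field) set \<Rightarrow> nat"
  where "ga_codim X = CARD('g) - ga.dim X"

text \<open>
  \<open>prod_set A k\<close> is the product set \<open>A\<^sub>1 A\<^sub>2 \<dots> A\<^sub>k\<close>, in this order.
\<close>

definition prod_set :: "(nat \<Rightarrow> 'g::group_add set) \<Rightarrow> nat \<Rightarrow> 'g set"
  where "prod_set A k = sum_list (map A [1..<Suc k])"

end

theory Submission
  imports Defs
begin

text \<open>
  Inside each \<open>A\<^sub>i\<close> choose a maximal \<open>B\<^sub>i\<close> such that \<open>X\<^sub>i\<close> has no nonzero element supported
  on \<open>B\<^sub>i\<close>; then \<open>|B\<^sub>i| \<le> t\<^sub>i\<close>, and by maximality every \<open>a \<in> A\<^sub>i - B\<^sub>i\<close> is the leading term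
  of some \<open>u\<^sub>a \<in> X\<^sub>i\<close> whose remaining terms lie in \<open>B\<^sub>i\<close>.  Let \<open>C\<close> be the part of
  \<open>A\<^sub>1 \<dots> A\<^sub>k\<close> not covered by the products with one factor \<open>B\<^sub>i\<close>.  If \<open>g = a\<^sub>1 \<dots> a\<^sub>k \<in> C\<close>, the product
  of the \<open>u\<^sub>a\<close> is \<open>g\<close> plus terms outside \<open>C\<close>, and \<open>X\<^sub>0\<close> annihilates it.  Hence an element
  of \<open>X\<^sub>0\<close> supported on the inverses of \<open>C\<close> vanishes, so \<open>|C| \<le> t\<^sub>0\<close>.
\<close>

text \<open>The basis elements indexed by \<open>B\<close> span a subspace of dimension
  \<open>card B\<close> that meets \<open>X\<close> only in 0. The sum of the two subspaces is
  therefore direct, and its dimension is at most \<open>CARD('g)\<close>.\<close>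

lemma card_le_ga_codim:
  fixes X :: "('g::{group_add,finite} \<Rightarrow>\<^sub>0 'f::field) set"
  assumes X: "ga.subspace X"
    and triv: "\<And>u. u \<in> X \<Longrightarrow> Poly_Mapping.keys u \<subseteq> B \<Longrightarrow> u = 0"
  shows "card B \<le> ga_codim X"
proof -
  let ?e = "\<lambda>g. Poly_Mapping.single g (1::'f) :: 'g \<Rightarrow>\<^sub>0 'f"
  have inj: "inj ?e"
    by (rule injI) (metis lookup_single_eq lookup_single_not_eq zero_neq_one)
  have expand: "u = (\<Sum>g\<in>UNIV. ga_scale (Poly_Mapping.lookup u g) (?e g))" for u :: "'g \<Rightarrow>\<^sub>0 'f"
    by (rule poly_mapping_eqI) (simp add: lookup_sum lookup_single when_def if_distrib cong: if_cong)
  have span: "ga.span (range ?e) = UNIV"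
  proof -
    have "u \<in> ga.span (range ?e)" for u
      by (subst expand[of u]) (intro ga.span_sum ga.span_scale ga.span_base, simp)
    then show ?thesis by blast
  qed
  have indep: "ga.independent (range ?e)"
  proof -
    \<comment> \<open>A maximal independent subfamily \<open>E\<close> still spans, so it has as
      many elements as the dimension, which is \<open>CARD('g)\<close>. This is also the size of the
      whole family, so nothing was discarded.\<close>
    obtain E where E: "E \<subseteq> range ?e" "ga.independent E" "range ?e \<subseteq> ga.span E"
      using ga.maximal_independent_subset by blast
    then have "ga.span E = UNIV"
      using span ga.span_minimal[of "range ?e" "ga.span E"] by auto
    then have "card E = card (range ?e)"
      using E(2) ga.dim_eq_card_independent[OF E(2)] ga.dim_span[of E]
      by (simp add: ga_dim_UNIV card_image[OF inj])
    then have "E = range ?e"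
      using E(1) by (intro card_subset_eq) auto
    then show ?thesis using E(2) by simp
  qed
  \<comment> \<open>The dimension formula for sums and intersections of subspaces becomes available
    through this finite basis.\<close>
  interpret fd: finite_dimensional_vector_space ga_scale "range ?e"
    by unfold_locales (auto simp: indep span)
  have supp: "Poly_Mapping.keys u \<subseteq> B" if "u \<in> ga.span (?e ` B)" for u
    using that
  proof (induction rule: ga.span_induct_alt)
    case base
    then show ?case by simp
  next
    case (step c x y)
    then show ?case
      by (auto simp: in_keys_iff lookup_add lookup_single when_def split: if_splits)
  qed
  have "X \<inter> ga.span (?e ` B) \<subseteq> {0}"
    using triv supp by blast
  then have "ga.dim (X \<inter> ga.span (?e ` B)) = 0"
    by (simp add: fd.dim_eq_0)
  moreover have "ga.dim (ga.span (?e ` B)) = card B"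
    using ga.dim_eq_card_independent[OF ga.independent_mono[OF indep, of "?e ` B"]]
    by (simp add: image_mono card_image inj_on_subset[OF inj])
  ultimately have "ga.dim X + card B = ga.dim {x + y |x y. x \<in> X \<and> y \<in> ga.span (?e ` B)}"
    using fd.dim_sums_Int[OF X ga.subspace_span, of "?e ` B"] by linarith
  also have "\<dots> \<le> CARD('g)"
    using fd.dim_subset_UNIV[of "{x + y |x y. x \<in> X \<and> y \<in> ga.span (?e ` B)}"]
    by (simp add: fd.dimension_def card_image[OF inj])
  finally show ?thesis by (simp add: ga_codim_def)
qed

text \<open>Modulo \<open>X\<close>, each element of \<open>A\<close> outside \<open>B\<close> is
  congruent to a linear combination of elements of \<open>B\<close>.\<close>

lemma exists_small_reduction_set:
  fixes X :: "('g::{group_add,finite} \<Rightarrow>\<^sub>0 'f::field) set"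
  assumes X: "ga.subspace X"
  shows "\<exists>B\<subseteq>A. card B \<le> ga_codim X \<and>
    (\<forall>a\<in>A - B. \<exists>u\<in>X. Poly_Mapping.keys (u - Poly_Mapping.single a 1) \<subseteq> B)"
proof -
  let ?F = "{B. B \<subseteq> A \<and> (\<forall>u\<in>X. Poly_Mapping.keys u \<subseteq> B \<longrightarrow> u = 0)}"
  have "{} \<in> ?F" by auto
  then obtain B where B: "B \<in> ?F" and max: "\<And>B'. B' \<in> ?F \<Longrightarrow> B \<subseteq> B' \<Longrightarrow> B = B'"
    using finite_has_maximal[of ?F] by (metis (no_types, lifting) empty_iff finite)
  have "\<exists>u\<in>X. Poly_Mapping.keys (u - Poly_Mapping.single a 1) \<subseteq> B" if a: "a \<in> A - B" for a
  proof -
    have "insert a B \<notin> ?F" using max[of "insert a B"] a by auto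
    then obtain u where u: "u \<in> X" "Poly_Mapping.keys u \<subseteq> insert a B" "u \<noteq> 0"
      using B a by auto
    \<comment> \<open>If the coefficient \<open>c\<close> vanished, \<open>u\<close> would be
      supported on \<open>B\<close> and hence be zero. Division by \<open>c\<close> makes the
      leading coefficient 1.\<close>
    define c where "c = Poly_Mapping.lookup u a"
    have "c \<noteq> 0"
      using B u unfolding c_def by (auto simp: in_keys_iff subset_iff)
    then have "Poly_Mapping.keys (ga_scale (inverse c) u - Poly_Mapping.single a 1) \<subseteq> B"
      using u(2) by (auto simp: in_keys_iff lookup_minus lookup_single when_def c_def subset_iff
          split: if_splits)
    moreover have "ga_scale (inverse c) u \<in> X"
      using X u(1) by (rule ga.subspace_scale)
    ultimately show ?thesis by blast
  qed
  then show ?thesis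
    using B card_le_ga_codim[OF X, of B] by blast
qed

lemma prod_set_0 [simp]: "prod_set A 0 = {0}"
  by (simp add: prod_set_def set_zero)

lemma prod_set_Suc [simp]: "prod_set A (Suc n) = prod_set A n + A (Suc n)"
  by (simp add: prod_set_def flip: set_zero)

lemma prod_set_cong: "(\<And>i. i \<in> {1..n} \<Longrightarrow> A i = A' i) \<Longrightarrow> prod_set A n = prod_set A' n"
  by (induction n) auto

lemma prod_setE:
  assumes "g \<in> prod_set A n"
  obtains a where "\<And>i. i \<in> {1..n} \<Longrightarrow> a i \<in> A i" "g = sum_list (map a [1..<Suc n])"
proof -
  have "\<exists>a. (\<forall>i\<in>{1..n}. a i \<in> A i) \<and> g = sum_list (map a [1..<Suc n])"
    using assms
  proof (induction n arbitrary: g)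
    case 0
    then show ?case by simp
  next
    case (Suc n)
    then obtain h b where g: "g = h + b" "h \<in> prod_set A n" "b \<in> A (Suc n)"
      by (auto elim: set_plus_elim)
    with Suc.IH obtain a where a: "\<forall>i\<in>{1..n}. a i \<in> A i" "h = sum_list (map a [1..<Suc n])"
      by blast
    have "map (a(Suc n := b)) [1..<Suc n] = map a [1..<Suc n]"
      by (rule map_cong) auto
    with a g have "(\<forall>i\<in>{1..Suc n}. (a(Suc n := b)) i \<in> A i) \<and>
        g = sum_list (map (a(Suc n := b)) [1..<Suc (Suc n)])"
      by (auto simp: le_Suc_eq)
    then show ?case by blast
  qed
  then show thesis using that by blast
qed

lemma sum_list_in_prod_set:
  "(\<And>i. i \<in> {1..n} \<Longrightarrow> a i \<in> A i) \<Longrightarrow> sum_list (map a [1..<Suc n]) \<in> prod_set A n"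
  by (induction n) (auto simp: set_plus_intro)

lemma keys_mult_subset:
  "Poly_Mapping.keys p \<subseteq> S \<Longrightarrow> Poly_Mapping.keys q \<subseteq> T \<Longrightarrow> Poly_Mapping.keys (p * q) \<subseteq> S + T"
  using keys_mult[of p q] by (blast intro: set_plus_intro)

text \<open>Induction on the number of factors. With \<open>w = g + r\<close> the product of the
  first \<open>n\<close> factors and \<open>u = a + s\<close> the next one,
  \<open>w * u - g * a = r * u + g * s\<close>. In the first summand an earlier factor already lies
  in its \<open>B i\<close>; in the second the new factor does.\<close>

lemma keys_prod_list_minus_single:
  fixes u :: "nat \<Rightarrow> ('g::group_add \<Rightarrow>\<^sub>0 'f::comm_ring_1)"
  assumes "\<And>i. i \<in> {1..n} \<Longrightarrow> a i \<in> A i" "\<And>i. i \<in> {1..n} \<Longrightarrow> B i \<subseteq> A i"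
    and "\<And>i. i \<in> {1..n} \<Longrightarrow> Poly_Mapping.keys (u i - Poly_Mapping.single (a i) 1) \<subseteq> B i"
  shows "Poly_Mapping.keys (prod_list (map u [1..<Suc n]) -
      Poly_Mapping.single (sum_list (map a [1..<Suc n])) 1) \<subseteq> (\<Union>i\<in>{1..n}. prod_set (A(i := B i)) n)"
  using assms
proof (induction n)
  case 0
  then show ?case by simp
next
  case (Suc n)
  let ?R = "\<lambda>n. \<Union>i\<in>{1..n}. prod_set (A(i := B i)) n"
  define g where "g = sum_list (map a [1..<Suc n])"
  define r where "r = prod_list (map u [1..<Suc n]) - Poly_Mapping.single g 1"
  define s where "s = u (Suc n) - Poly_Mapping.single (a (Suc n)) 1"
  have r: "Poly_Mapping.keys r \<subseteq> ?R n"
    unfolding r_def g_def by (intro Suc.IH) (use Suc.prems in auto)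
  have s: "Poly_Mapping.keys s \<subseteq> B (Suc n)"
    unfolding s_def using Suc.prems by simp
  have u: "u (Suc n) = Poly_Mapping.single (a (Suc n)) 1 + s"
    by (simp add: s_def)
  have "Poly_Mapping.keys (u (Suc n)) \<subseteq> A (Suc n)"
    using keys_add[of "Poly_Mapping.single (a (Suc n)) 1" s] s Suc.prems(1,2)[of "Suc n"]
    unfolding u by auto
  with r have 1: "Poly_Mapping.keys (r * u (Suc n)) \<subseteq> ?R n + A (Suc n)"
    by (rule keys_mult_subset)
  have "g \<in> prod_set A n"
    unfolding g_def using Suc.prems(1) by (intro sum_list_in_prod_set) simp
  then have 2: "Poly_Mapping.keys (Poly_Mapping.single g 1 * s) \<subseteq> prod_set A n + B (Suc n)"
    using s by (intro keys_mult_subset) auto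
  have "prod_set (A(Suc n := B (Suc n))) n = prod_set A n"
    by (rule prod_set_cong) auto
  then have "prod_set A n + B (Suc n) = prod_set (A(Suc n := B (Suc n))) (Suc n)"
    by simp
  also have "\<dots> \<subseteq> ?R (Suc n)"
    by (rule UN_upper) simp
  finally have "prod_set A n + B (Suc n) \<subseteq> ?R (Suc n)" .
  moreover have "?R n + A (Suc n) \<subseteq> ?R (Suc n)"
  proof
    fix x assume "x \<in> ?R n + A (Suc n)"
    then obtain i where i: "i \<in> {1..n}" "x \<in> prod_set (A(i := B i)) n + A (Suc n)"
      by (blast elim: set_plus_elim intro: set_plus_intro)
    \<comment> \<open>Since \<open>i \<le> n\<close>, the update at \<open>i\<close> leaves the last
      factor \<open>A (Suc n)\<close> intact.\<close>
    then have "x \<in> prod_set (A(i := B i)) (Suc n)"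
      by simp
    with i(1) show "x \<in> ?R (Suc n)"
      by (intro UN_I[of i]) auto
  qed
  moreover have "prod_list (map u [1..<Suc (Suc n)]) -
      Poly_Mapping.single (sum_list (map a [1..<Suc (Suc n)])) 1 =
      r * u (Suc n) + Poly_Mapping.single g 1 * s"
    by (simp add: r_def s_def algebra_simps mult_single g_def)
  ultimately show ?case
    using 1 2 keys_add[of "r * u (Suc n)" "Poly_Mapping.single g 1 * s"]
    by (simp only:) blast
qed

text \<open>Right translation by \<open>g\<close> carries \<open>- g\<close>, and no other element,
  to 0. So once the term of \<open>v\<close> at \<open>- g\<close> is split off, the remainder
  \<open>r\<close> contributes nothing at 0.\<close>

lemma lookup_mult_single_0:
  fixes v :: "'g::group_add \<Rightarrow>\<^sub>0 'f::comm_ring_1"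
  shows "Poly_Mapping.lookup (v * Poly_Mapping.single g 1) 0 = Poly_Mapping.lookup v (- g)"
proof -
  define c where "c = Poly_Mapping.lookup v (- g)"
  define r where "r = v - Poly_Mapping.single (- g) c"
  have "- g \<notin> Poly_Mapping.keys r"
    by (simp add: r_def c_def in_keys_iff lookup_minus)
  then have "0 \<notin> Poly_Mapping.keys (r * Poly_Mapping.single g 1)"
    using keys_mult[of r "Poly_Mapping.single g 1"]
    by (auto simp flip: eq_neg_iff_add_eq_0 split: if_splits)
  moreover have "v * Poly_Mapping.single g 1 = Poly_Mapping.single 0 c + r * Poly_Mapping.single g 1"
    by (simp add: r_def algebra_simps mult_single)
  ultimately show ?thesis
    by (simp add: lookup_add in_keys_iff c_def)
qed

theorem theorem4:
  fixes k :: nat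
    and X :: "nat \<Rightarrow> ('g::{group_add,finite} \<Rightarrow>\<^sub>0 'f::field) set"
    and A :: "nat \<Rightarrow> 'g set"
  assumes "k \<ge> 1"
    and "\<And>i. i \<le> k \<Longrightarrow> ga.subspace (X i)"
    and "\<And>u. (\<And>i. i \<le> k \<Longrightarrow> u i \<in> X i) \<Longrightarrow> prod_list (map u [0..<Suc k]) = 0"
  shows "\<exists>(B :: nat \<Rightarrow> 'g set) (C :: 'g set).
      (\<forall>i\<in>{1..k}. B i \<subseteq> A i) \<and>
      card C \<le> ga_codim (X 0) \<and>
      (\<forall>i\<in>{1..k}. card (B i) \<le> ga_codim (X i)) \<and>
      prod_set A k \<subseteq> C \<union> (\<Union>i\<in>{1..k}. prod_set (A(i := B i)) k) \<and>
      (\<forall>i j. 1 \<le> i \<and> i < j \<and> j \<le> k \<and> X i = X j \<and> A i = A j \<longrightarrow> B i = B j)"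
proof -
  note sub = assms(2) and ann = assms(3)
  \<comment> \<open>The choice is made once, as a function \<open>\<beta>\<close> of the subspace
    and the set alone and not of the index. Equal pairs \<open>X i\<close>, \<open>A i\<close> thus
    receive equal \<open>B i\<close>.\<close>
  have "\<forall>Y S. ga.subspace (Y :: ('g \<Rightarrow>\<^sub>0 'f) set) \<longrightarrow> (\<exists>B\<subseteq>S. card B \<le> ga_codim Y \<and>
      (\<forall>a\<in>S - B. \<exists>u\<in>Y. Poly_Mapping.keys (u - Poly_Mapping.single a 1) \<subseteq> B))"
    by (intro allI impI exists_small_reduction_set)
  then obtain \<beta> where \<beta>: "\<And>Y S. ga.subspace (Y :: ('g \<Rightarrow>\<^sub>0 'f) set) \<Longrightarrow> \<beta> Y S \<subseteq> S \<and>
      card (\<beta> Y S) \<le> ga_codim Y \<and>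
      (\<forall>a\<in>S - \<beta> Y S. \<exists>u\<in>Y. Poly_Mapping.keys (u - Poly_Mapping.single a 1) \<subseteq> \<beta> Y S)"
    by metis
  define B where "B = (\<lambda>i. \<beta> (X i) (A i))"
  have B: "B i \<subseteq> A i" "card (B i) \<le> ga_codim (X i)"
    "\<And>a. a \<in> A i - B i \<Longrightarrow> \<exists>u\<in>X i. Poly_Mapping.keys (u - Poly_Mapping.single a 1) \<subseteq> B i"
    if "i \<le> k" for i
    using \<beta>[OF sub[OF that], of "A i"] unfolding B_def by auto
  define R where "R = (\<Union>i\<in>{1..k}. prod_set (A(i := B i)) k)"
  define C where "C = prod_set A k - R"
  \<comment> \<open>Negatives appear because the coefficient of \<open>v\<close> at
    \<open>- g\<close> is the one that a product with \<open>g\<close> moves to 0. Negation is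
    injective, so the bound passes to \<open>C\<close>.\<close>
  have "card (uminus ` C) \<le> ga_codim (X 0)"
  proof (rule card_le_ga_codim)
    show "ga.subspace (X 0)" by (simp add: sub)
    fix v assume v: "v \<in> X 0" "Poly_Mapping.keys v \<subseteq> uminus ` C"
    have "Poly_Mapping.lookup v (- g) = 0" if g: "g \<in> C" for g
    proof -
      obtain a where a: "\<And>i. i \<in> {1..k} \<Longrightarrow> a i \<in> A i" "g = sum_list (map a [1..<Suc k])"
        using g unfolding C_def by (blast elim: prod_setE)
      have "a i \<in> A i - B i" if i: "i \<in> {1..k}" for i
      proof -
        \<comment> \<open>A factor in \<open>B i\<close> would put \<open>g\<close> into
          \<open>R\<close>, which is disjoint from \<open>C\<close>.\<close>
        have "g \<in> prod_set (A(i := B i)) k" if "a i \<in> B i"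
          unfolding a(2) using a(1) that by (intro sum_list_in_prod_set) auto
        then show ?thesis using a(1) i g unfolding C_def R_def by blast
      qed
      then have "\<forall>i\<in>{1..k}. \<exists>u\<in>X i. Poly_Mapping.keys (u - Poly_Mapping.single (a i) 1) \<subseteq> B i"
        using B(3) by simp
      then obtain u where u: "\<And>i. i \<in> {1..k} \<Longrightarrow> u i \<in> X i"
        "\<And>i. i \<in> {1..k} \<Longrightarrow> Poly_Mapping.keys (u i - Poly_Mapping.single (a i) 1) \<subseteq> B i"
        by metis
      define w where "w = prod_list (map u [1..<Suc k])"
      define r where "r = w - Poly_Mapping.single g 1"
      have r: "Poly_Mapping.keys r \<subseteq> R"
        unfolding r_def R_def w_def a(2) using a(1) B(1) u(2)
        by (intro keys_prod_list_minus_single) auto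
      \<comment> \<open>The value of \<open>u\<close> at 0 is arbitrary so far; putting
        \<open>v\<close> there gives an admissible family for the annihilation hypothesis.\<close>
      have "prod_list (map (u(0 := v)) [0..<Suc k]) = 0"
        using v(1) u(1) by (intro ann) (auto simp: Suc_le_eq)
      moreover have "map (u(0 := v)) [0..<Suc k] = v # map u [1..<Suc k]"
        by (subst upt_conv_Cons) auto
      ultimately have "v * w = 0"
        by (simp add: w_def del: upt_Suc)
      then have "v * Poly_Mapping.single g 1 + v * r = 0"
        by (simp add: r_def algebra_simps)
      then have "Poly_Mapping.lookup (v * Poly_Mapping.single g 1) 0
          + Poly_Mapping.lookup (v * r) 0 = 0"
        by (metis lookup_add lookup_zero)
      \<comment> \<open>A term of \<open>v * r\<close> at 0 would require \<open>- x + y = 0\<close>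
        with \<open>x\<close> in \<open>C\<close> and \<open>y\<close> in \<open>R\<close>, that is,
        a common element of \<open>C\<close> and \<open>R\<close>.\<close>
      moreover have "0 \<notin> Poly_Mapping.keys (v * r)"
      proof
        assume "0 \<in> Poly_Mapping.keys (v * r)"
        then have "0 \<in> uminus ` C + R"
          using keys_mult_subset[OF v(2) r] by blast
        then obtain x y where "0 = - x + y" "x \<in> C" "y \<in> R"
          by (auto elim: set_plus_elim)
        then show False
          by (metis C_def DiffD2 add.right_neutral minus_add_cancel neg_eq_iff_add_eq_0 neg_equal_iff_equal)
      qed
      moreover have "Poly_Mapping.lookup (v * Poly_Mapping.single g 1) 0 = Poly_Mapping.lookup v (- g)"
        by (rule lookup_mult_single_0)
      ultimately show ?thesis
        by (simp add: in_keys_iff)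
    qed
    then show "v = 0"
      using v(2) by (intro poly_mapping_eqI) (auto simp: in_keys_iff subset_iff image_iff)
  qed
  then have C: "card C \<le> ga_codim (X 0)"
    by (simp add: card_image)
  show ?thesis
  proof (intro exI conjI)
    show "prod_set A k \<subseteq> C \<union> (\<Union>i\<in>{1..k}. prod_set (A(i := B i)) k)"
      unfolding C_def R_def by blast
    show "\<forall>i j. 1 \<le> i \<and> i < j \<and> j \<le> k \<and> X i = X j \<and> A i = A j \<longrightarrow> B i = B j"
      by (simp add: B_def)
  qed (use B C in auto)
qed

end
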